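(* Let $(G,D)$ be a connected $3$-transposition group, $M=M_\eta(G,D)$, let $\sigma$ be a flip of $M$ and $W=[M,\sigma]=\{u-u^\sigma\mid u\in M\}$. Let $k=|\{e\in D\mid |de|=3\}|$ for $d\in D$ (independent of $d$), which is an eigenvalue of the collinearity map $t$ on $M$, and let $m_k$ be the dimension of the $k$-eigenspace of $t$ in $W$. Then $m_k=0$.
   Context: $\mathbb F$ is a field of characteristic $0$ and $\eta\in\mathbb F\setminus\{0,1\}$. A $3$-transposition group $(G,D)$ is a finite group $G$ with a normal generating subset $D$ of elements of order $2$ such that $|de|\le 3$ for all $d,e\in D$; it is connected if $D$ is a single conjugacy class. As a vector space, the Matsuo algebra $M=M_\eta(G,D)$ is the $\mathbb F$-space with basis $D$ (the algebra product is not needed here). A flip $\sigma$ of $M$ is an automorphism of order $2$ of the group $G$ with $D^\sigma=D$, acting linearly on $M$ by permuting the basis $D$. The collinearity map is the linear map $t:M\to M$ with $t(d)=\sum_{c\in D,\,|cd|=3}c$ for $d\in D$. It commutes with $\sigma$, so it leaves $W$ invariant. *)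

theory Defs
  imports "HOL-Algebra.Algebra" "HOL-Library.Poly_Mapping"
begin

locale three_transposition_group = group G for G (structure) +
  fixes D
  assumes finite_carrier: "finite (carrier G)"
    and D_subset: "D \<subseteq> carrier G"
    and D_normal: "\<lbrakk>g \<in> carrier G; d \<in> D\<rbrakk> \<Longrightarrow> inv g \<otimes> d \<otimes> g \<in> D"
    and D_generates: "generate G D = carrier G"
    and D_involution: "d \<in> D \<Longrightarrow> ord d = 2"
    and D_product: "\<lbrakk>d \<in> D; e \<in> D\<rbrakk> \<Longrightarrow> ord (d \<otimes> e) \<le> 3"

locale connected_three_transposition_group = three_transposition_group +
  assumes single_class: "\<exists>d \<in> carrier G. D = {inv g \<otimes> d \<otimes> g | g. g \<in> carrier G}"

text \<open>
  In \<^term>\<open>auto G\<close> automorphisms are extensional, so that the order in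
  \<^term>\<open>AutoGroup G\<close> depends only on the values on the carrier.
\<close>

definition flip :: "('g, 'b) monoid_scheme \<Rightarrow> 'g set \<Rightarrow> ('g \<Rightarrow> 'g) \<Rightarrow> bool" where
  "flip G D \<sigma> \<longleftrightarrow> \<sigma> \<in> auto G \<and> group.ord (AutoGroup G) \<sigma> = 2 \<and> \<sigma> ` D = D"

text \<open>
  Formal linear combinations of group elements over a field; \<open>d\<close> as a basis
  vector is \<^term>\<open>Poly_Mapping.single d 1\<close>.
\<close>

definition scale :: "'f::field \<Rightarrow> ('g \<Rightarrow>\<^sub>0 'f) \<Rightarrow> ('g \<Rightarrow>\<^sub>0 'f)" where
  "scale a v = Poly_Mapping.map ((*) a) v"

lemma lookup_scale [simp]: "Poly_Mapping.lookup (scale a v) x = a * Poly_Mapping.lookup v x"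
  by (simp add: scale_def Poly_Mapping.map.rep_eq when_def)

global_interpretation free_space: vector_space "scale :: 'f::field \<Rightarrow> ('g \<Rightarrow>\<^sub>0 'f) \<Rightarrow> _"
  by unfold_locales (auto intro!: poly_mapping_eqI simp: lookup_add algebra_simps)

definition linear_extension :: "('g \<Rightarrow> ('g \<Rightarrow>\<^sub>0 'f)) \<Rightarrow> ('g \<Rightarrow>\<^sub>0 'f) \<Rightarrow> ('g \<Rightarrow>\<^sub>0 'f::field)" where
  "linear_extension f v = (\<Sum>d \<in> Poly_Mapping.keys v. scale (Poly_Mapping.lookup v d) (f d))"

text \<open>
  The underlying vector space of the Matsuo algebra; only its product involves
  the parameter \<open>\<eta>\<close> and the group structure.
\<close>

definition matsuo_space :: "'g set \<Rightarrow> ('g \<Rightarrow>\<^sub>0 'f::field) set" where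
  "matsuo_space D = {v. Poly_Mapping.keys v \<subseteq> D}"

definition flip_action :: "('g \<Rightarrow> 'g) \<Rightarrow> ('g \<Rightarrow>\<^sub>0 'f) \<Rightarrow> ('g \<Rightarrow>\<^sub>0 'f::field)" where
  "flip_action \<sigma> = linear_extension (\<lambda>d. Poly_Mapping.single (\<sigma> d) 1)"

definition flip_commutator :: "'g set \<Rightarrow> ('g \<Rightarrow> 'g) \<Rightarrow> ('g \<Rightarrow>\<^sub>0 'f::field) set" where
  "flip_commutator D \<sigma> = {u - flip_action \<sigma> u | u. u \<in> matsuo_space D}"

definition collinearity_map ::
    "('g, 'b) monoid_scheme \<Rightarrow> 'g set \<Rightarrow> ('g \<Rightarrow>\<^sub>0 'f) \<Rightarrow> ('g \<Rightarrow>\<^sub>0 'f::field)" where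
  "collinearity_map G D = linear_extension
     (\<lambda>d. \<Sum>c \<in> {c \<in> D. group.ord G (c \<otimes>\<^bsub>G\<^esub> d) = 3}. Poly_Mapping.single c 1)"

definition valency :: "('g, 'b) monoid_scheme \<Rightarrow> 'g set \<Rightarrow> 'g \<Rightarrow> nat" where
  "valency G D d = card {e \<in> D. group.ord G (d \<otimes>\<^bsub>G\<^esub> e) = 3}"

definition eigenspace_in ::
    "('g \<Rightarrow>\<^sub>0 'f) set \<Rightarrow> (('g \<Rightarrow>\<^sub>0 'f) \<Rightarrow> ('g \<Rightarrow>\<^sub>0 'f)) \<Rightarrow> 'f \<Rightarrow> ('g \<Rightarrow>\<^sub>0 'f::field) set" where
  "eigenspace_in U T a = {u \<in> U. T u = scale a u}"

lemma linear_extension_superset: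
  assumes "finite A" "Poly_Mapping.keys v \<subseteq> A"
  shows "linear_extension f v = (\<Sum>d \<in> A. scale (Poly_Mapping.lookup v d) (f d))"
  unfolding linear_extension_def
  using assms by (intro sum.mono_neutral_left) (auto simp: in_keys_iff)

lemma linear_extension_single [simp]: "linear_extension f (Poly_Mapping.single d 1) = f d"
  by (simp add: linear_extension_def)

lemma linear_linear_extension:
  fixes f :: "'g \<Rightarrow> ('g \<Rightarrow>\<^sub>0 'f::field)"
  shows "Vector_Spaces.linear scale scale (linear_extension f)"
proof (rule Vector_Spaces.linear.intro)
  show "vector_space (scale :: 'f \<Rightarrow> ('g \<Rightarrow>\<^sub>0 'f) \<Rightarrow> _)"
    by (rule free_space.vector_space_axioms)
  then show "vector_space (scale :: 'f \<Rightarrow> ('g \<Rightarrow>\<^sub>0 'f) \<Rightarrow> _)" .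
  show "module_hom scale scale (linear_extension f)"
  proof
    fix v w :: "'g \<Rightarrow>\<^sub>0 'f" and a
    let ?A = "Poly_Mapping.keys v \<union> Poly_Mapping.keys w"
    have "Poly_Mapping.keys (v + w) \<subseteq> ?A" by (rule Poly_Mapping.keys_add)
    then show "linear_extension f (v + w) = linear_extension f v + linear_extension f w"
      by (simp add: linear_extension_superset[of ?A] lookup_add free_space.scale_left_distrib
          sum.distrib)
    have "Poly_Mapping.keys (scale a v) \<subseteq> Poly_Mapping.keys v" by (auto simp: in_keys_iff)
    then show "linear_extension f (scale a v) = scale a (linear_extension f v)"
      by (simp add: linear_extension_superset[of "Poly_Mapping.keys v"] free_space.scale_sum_right)
  qed
qed

context three_transposition_group
begin

lemma inv_cancel_left:
  assumes "x \<in> carrier G" "y \<in> carrier G"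
  shows "x \<otimes> (inv x \<otimes> y) = y" "inv x \<otimes> (x \<otimes> y) = y"
  using assms by (simp_all add: m_assoc[symmetric])

lemma conj_order_3:
  assumes "g \<in> carrier G" "x \<in> carrier G" "ord x = 3"
  shows "ord (inv g \<otimes> x \<otimes> g) = 3"
proof -
  have pow: "(inv g \<otimes> x \<otimes> g) [^] n = inv g \<otimes> (x [^] n) \<otimes> g" for n :: nat
    using assms(1,2) by (induction n) (simp_all add: m_assoc inv_cancel_left)
  have "(inv g \<otimes> x \<otimes> g) [^] n = \<one> \<longleftrightarrow> x [^] n = \<one>" for n :: nat
    using assms(1,2) unfolding pow
    by (metis inv_closed inv_equality inv_inv l_inv m_assoc nat_pow_closed r_one m_closed)
  then show ?thesis
    using assms by (metis (no_types, lifting) inv_closed m_closed ord_unique pow_eq_id)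
qed

lemma ord_product_commute:
  assumes "d \<in> D" "e \<in> D" "ord (d \<otimes> e) = 3"
  shows "ord (e \<otimes> d) = 3"
proof -
  have "d \<in> carrier G" "e \<in> carrier G" using assms D_subset by auto
  moreover from this have "inv d \<otimes> (d \<otimes> e) \<otimes> d = e \<otimes> d" by (simp add: m_assoc[symmetric])
  ultimately show ?thesis using conj_order_3[of d "d \<otimes> e"] assms by simp
qed

end

context connected_three_transposition_group
begin

lemma valency_le:
  assumes "d \<in> D" "e \<in> D"
  shows "valency G D d \<le> valency G D e"
proof -
  obtain a g h where a: "a \<in> carrier G" and g: "g \<in> carrier G" and h: "h \<in> carrier G"
    and d: "d = inv g \<otimes> a \<otimes> g" and e: "e = inv h \<otimes> a \<otimes> h"
    using single_class assms by blast
  define x where "x = inv g \<otimes> h"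
  have x: "x \<in> carrier G" using g h by (simp add: x_def)
  have dx: "inv x \<otimes> d \<otimes> x = e"
    using a g h by (simp add: x_def d e m_assoc inv_mult_group inv_cancel_left)
  have dc: "d \<in> carrier G" using assms D_subset by auto
  show ?thesis unfolding valency_def
  proof (rule card_inj_on_le)
    show "inj_on (\<lambda>c. inv x \<otimes> c \<otimes> x) {e \<in> D. ord (d \<otimes> e) = 3}"
      using x D_subset by (auto simp: inj_on_def subset_iff)
    show "(\<lambda>c. inv x \<otimes> c \<otimes> x) ` {e \<in> D. ord (d \<otimes> e) = 3} \<subseteq> {c \<in> D. ord (e \<otimes> c) = 3}"
    proof clarify
      fix c assume c: "c \<in> D" "ord (d \<otimes> c) = 3"
      then have cc: "c \<in> carrier G" using D_subset by auto
      have "e \<otimes> (inv x \<otimes> c \<otimes> x) = inv x \<otimes> (d \<otimes> c) \<otimes> x"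
        using x cc dc unfolding dx[symmetric] by (simp add: m_assoc inv_cancel_left)
      then show "inv x \<otimes> c \<otimes> x \<in> D \<and> ord (e \<otimes> (inv x \<otimes> c \<otimes> x)) = 3"
        using conj_order_3[of x "d \<otimes> c"] x cc dc c D_normal by simp
    qed
    show "finite {c \<in> D. ord (e \<otimes> c) = 3}"
      using finite_subset[OF D_subset finite_carrier] by simp
  qed
qed

lemma valency_independent: "\<lbrakk>d \<in> D; e \<in> D\<rbrakk> \<Longrightarrow> valency G D d = valency G D e"
  by (simp add: valency_le order_antisym)

lemma valency_eigenvalue:
  assumes "d \<in> D"
  shows "\<exists>v \<in> eigenspace_in (matsuo_space D) (collinearity_map G D)
           (of_nat (valency G D d) :: 'f::field). v \<noteq> 0"
proof
  have fin: "finite D" using finite_subset[OF D_subset finite_carrier] .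
  define v :: "_ \<Rightarrow>\<^sub>0 'f" where "v = (\<Sum>c \<in> D. Poly_Mapping.single c 1)"
  have lv: "Poly_Mapping.lookup v x = (if x \<in> D then 1 else 0)" for x
    using fin by (simp add: v_def lookup_sum lookup_single when_def)
  have kv: "Poly_Mapping.keys v = D" by (auto simp: in_keys_iff lv split: if_splits)
  show "v \<noteq> 0" using kv assms by auto
  have "Poly_Mapping.lookup (collinearity_map G D v) x = of_nat (valency G D d) * Poly_Mapping.lookup v x" for x
  proof -
    have "Poly_Mapping.lookup (collinearity_map G D v) x
        = (\<Sum>e \<in> D. if x \<in> D \<and> ord (x \<otimes> e) = 3 then 1 else 0)"
      unfolding collinearity_map_def linear_extension_def kv lookup_sum
      using fin by (intro sum.cong) (auto simp: lv lookup_sum lookup_single when_def)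
    also have "\<dots> = (if x \<in> D then of_nat (valency G D x) else 0)"
      using fin by (auto simp: valency_def sum.If_cases Int_def)
    finally show ?thesis using valency_independent[OF assms] by (simp add: lv)
  qed
  then show "v \<in> eigenspace_in (matsuo_space D) (collinearity_map G D) (of_nat (valency G D d))"
    by (auto simp: eigenspace_in_def matsuo_space_def kv intro!: poly_mapping_eqI)
qed

end

end

theory Submission
  imports Defs
begin

text \<open>
  A \<open>k\<close>-eigenvector of the adjacency map of a \<open>k\<close>-regular graph is a harmonic function.
  Over the rationals the maximum principle makes it constant on a connected graph, and over a
  field of characteristic \<open>0\<close> this follows by applying \<open>\<rat>\<close>-linear functionals.
  The collinearity graph on \<open>D\<close> is connected because \<open>c\<^sup>e\<close> is equal or adjacent to \<open>c\<close>, for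
  \<open>c, e\<close> in \<open>D\<close>, and \<open>D\<close> generates \<open>G\<close>. So the \<open>k\<close>-eigenspace in \<open>M\<close> is spanned by the sum of
  \<open>D\<close>, whereas the coordinates of a vector in \<open>[M, \<sigma>]\<close> add up to \<open>0\<close>.
\<close>

text \<open>\<open>x\<close> is extended to a basis of the field over \<rat>, acting through
  \<open>of_rat\<close>, and \<open>\<phi>\<close> is prescribed to be 1 on \<open>x\<close>.
  Additivity is all that is kept, because harmonicity involves only sums and differences.\<close>

lemma rational_functional_nonzero:
  fixes x :: "'f::field_char_0"
  assumes "x \<noteq> 0"
  shows "\<exists>\<phi> :: 'f \<Rightarrow> rat. additive \<phi> \<and> \<phi> x \<noteq> 0"
proof -
  interpret Q: vector_space_pair "\<lambda>q (y::'f). of_rat q * y" "(*) :: rat \<Rightarrow> rat \<Rightarrow> rat"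
    by unfold_locales (auto simp: algebra_simps of_rat_add of_rat_mult)
  have "\<not> Q.vs1.dependent {x}" using assms by simp
  from Q.linear_independent_extend[OF this, of "\<lambda>_. 1"]
  obtain \<phi> where \<phi>: "Vector_Spaces.linear (\<lambda>q (y::'f). of_rat q * y) (*) \<phi>" "\<phi> x = 1" by auto
  then have "additive \<phi>" by unfold_locales (rule Q.linear_add)
  with \<phi>(2) show ?thesis by auto
qed

text \<open>Maximum principle: where \<open>f\<close> attains its maximum, the terms
  \<open>f y - f z\<close> are nonnegative with sum 0, so every neighbour attains it too.\<close>

lemma harmonic_constant_linordered:
  fixes f :: "'a \<Rightarrow> 'b::linordered_idom"
  assumes fin: "finite V" and sub: "\<And>x. x \<in> V \<Longrightarrow> N x \<subseteq> V"
    and conn: "\<And>x y. \<lbrakk>x \<in> V; y \<in> V\<rbrakk> \<Longrightarrow> (x, y) \<in> {(x, y). x \<in> V \<and> y \<in> N x}\<^sup>*"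
    and harm: "\<And>x. x \<in> V \<Longrightarrow> (\<Sum>y \<in> N x. f y - f x) = 0"
    and "x \<in> V" "y \<in> V"
  shows "f x = f y"
proof -
  have "Max (f ` V) \<in> f ` V" using fin \<open>x \<in> V\<close> by (intro Max_in) auto
  then obtain m where m: "m \<in> V" "f m = Max (f ` V)" by auto
  then have le: "f z \<le> f m" if "z \<in> V" for z using fin that by simp
  \<comment> \<open>The maximal value is propagated along a path from \<open>m\<close> to
    \<open>z\<close>.\<close>
  have "f z = f m" if "z \<in> V" for z
    using conn[OF m(1) that]
  proof (induction rule: rtrancl_induct)
    case (step y z)
    then have y: "y \<in> V" "z \<in> N y" by auto
    have "f z - f y = 0"
    proof -
      have "\<forall>z \<in> N y. 0 \<le> f y - f z" using le sub y(1) step.IH by auto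
      moreover have "finite (N y)" using sub[OF y(1)] fin finite_subset by auto
      moreover have "(\<Sum>z \<in> N y. f y - f z) = 0"
        using harm[OF y(1)] by (simp add: sum_subtractf)
      ultimately have "\<forall>z \<in> N y. f y - f z = 0" by (simp add: sum_nonneg_eq_0_iff)
      then show ?thesis using y(2) by simp
    qed
    then show ?case using step.IH by simp
  qed simp
  then show ?thesis using assms(5,6) by simp
qed

text \<open>Two distinct values would be separated by some additive \<open>\<phi>\<close> into
  \<rat>, but \<open>\<phi>\<close> composed with \<open>f\<close> is again harmonic, hence
  constant.\<close>

lemma harmonic_constant:
  fixes f :: "'a \<Rightarrow> 'f::field_char_0"
  assumes "finite V" "\<And>x. x \<in> V \<Longrightarrow> N x \<subseteq> V"
    and "\<And>x y. \<lbrakk>x \<in> V; y \<in> V\<rbrakk> \<Longrightarrow> (x, y) \<in> {(x, y). x \<in> V \<and> y \<in> N x}\<^sup>*"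
    and harm: "\<And>x. x \<in> V \<Longrightarrow> (\<Sum>y \<in> N x. f y - f x) = 0"
    and "x \<in> V" "y \<in> V"
  shows "f x = f y"
proof (rule ccontr)
  assume "f x \<noteq> f y"
  then obtain \<phi> :: "'f \<Rightarrow> rat" where "additive \<phi>" and nz: "\<phi> (f x - f y) \<noteq> 0"
    using rational_functional_nonzero[of "f x - f y"] by auto
  interpret additive \<phi> by fact
  have "(\<Sum>y \<in> N x. \<phi> (f y) - \<phi> (f x)) = 0" if "x \<in> V" for x
    using harm[OF that] by (simp flip: diff sum add: zero)
  from harmonic_constant_linordered[of V N "\<lambda>x. \<phi> (f x)", OF assms(1-3) this assms(5,6)]
  have "\<phi> (f x) = \<phi> (f y)" by simp
  then show False using nz by (simp add: diff)
qed

context three_transposition_group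
begin

lemma D_carrier: "d \<in> D \<Longrightarrow> d \<in> carrier G"
  using D_subset by auto

lemma D_square: "d \<in> D \<Longrightarrow> d \<otimes> d = \<one>"
  using pow_ord_eq_1[of d] D_involution[of d] D_carrier[of d] by (simp add: numeral_2_eq_2)

lemma D_inv: "d \<in> D \<Longrightarrow> inv d = d"
  using D_square D_carrier by (simp add: inv_equality)

text \<open>If \<open>c \<otimes> e\<close> has order at most 2, then \<open>c\<close> and
  \<open>e\<close> commute. Otherwise the product of \<open>c\<close> and its conjugate is the
  square of \<open>c \<otimes> e\<close>, and squaring preserves order 3.\<close>

lemma conj_eq_or_adjacent:
  assumes c: "c \<in> D" and e: "e \<in> D"
  shows "e \<otimes> c \<otimes> e = c \<or> ord (c \<otimes> (e \<otimes> c \<otimes> e)) = 3"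
proof -
  note cc = D_carrier[OF c] D_carrier[OF e]
  note sq = D_square[OF c] D_square[OF e]
  have ce: "c \<otimes> e \<in> carrier G" using cc by simp
  \<comment> \<open>\<open>ord\<close> is 0 on elements of infinite order, a value that the bound by
    3 alone would admit; finiteness of the group excludes it.\<close>
  have "ord (c \<otimes> e) \<ge> 1" using ord_ge_1[OF finite_carrier ce] .
  then consider "ord (c \<otimes> e) = 1 \<or> ord (c \<otimes> e) = 2" | "ord (c \<otimes> e) = 3"
    using D_product[OF c e] by linarith
  then show ?thesis
  proof cases
    case 1
    then have "(c \<otimes> e) \<otimes> (c \<otimes> e) = \<one>"
      using pow_eq_id[OF ce, of 2] ce by (auto simp add: numeral_2_eq_2)
    then have "c \<otimes> (e \<otimes> c \<otimes> e) = c \<otimes> c" using cc sq by (simp add: m_assoc)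
    then show ?thesis using cc by simp
  next
    case 2
    have "c \<otimes> (e \<otimes> c \<otimes> e) = (c \<otimes> e) [^] (2::nat)"
      using cc by (simp add: numeral_2_eq_2 m_assoc)
    moreover have "ord ((c \<otimes> e) [^] (2::nat)) = 3"
      using ord_pow_gen[OF ce, of 2] 2 by simp
    ultimately show ?thesis by simp
  qed
qed

end

context connected_three_transposition_group
begin

lemma collinearity_connected:
  assumes "c \<in> D" "d \<in> D"
  shows "(c, d) \<in> {(x, y). x \<in> D \<and> y \<in> {e \<in> D. ord (x \<otimes> e) = 3}}\<^sup>*" (is "_ \<in> ?R\<^sup>*")
proof -
  have D_step: "(x, inv e \<otimes> x \<otimes> e) \<in> ?R\<^sup>*" if "x \<in> D" "e \<in> D" for x e
    using conj_eq_or_adjacent[OF that] D_normal[OF D_carrier[OF that(2)] that(1)] that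
    by (auto simp: D_inv)
  \<comment> \<open>Conjugation by a word in \<open>D\<close> traces a path, one letter at a time.
    The vertex stays arbitrary since in a product the second factor acts on a vertex already moved
    by the first.\<close>
  have step: "(x, inv g \<otimes> x \<otimes> g) \<in> ?R\<^sup>*" if "g \<in> generate G D" "x \<in> D" for g x
    using that
  proof (induction arbitrary: x rule: generate.induct)
    case one
    then show ?case using D_carrier by simp
  next
    case (incl h)
    then show ?case using D_step by simp
  next
    case (inv h)
    then show ?case using D_step[of x h] by (simp add: D_inv)
  next
    case (eng g h)
    have gh: "g \<in> carrier G" "h \<in> carrier G" using eng.hyps D_generates by auto
    have "inv (g \<otimes> h) \<otimes> x \<otimes> (g \<otimes> h) = inv h \<otimes> (inv g \<otimes> x \<otimes> g) \<otimes> h"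
      using gh D_carrier[OF eng.prems] by (simp add: inv_mult_group m_assoc)
    then show ?case
      using eng.IH(1)[OF eng.prems] eng.IH(2)[OF D_normal[OF gh(1) eng.prems]]
      by (simp add: rtrancl_trans)
  qed
  obtain a g h where a: "a \<in> carrier G" and g: "g \<in> carrier G" and h: "h \<in> carrier G"
    and c: "c = inv g \<otimes> a \<otimes> g" and d: "d = inv h \<otimes> a \<otimes> h"
    using single_class assms by blast
  \<comment> \<open>Going back from \<open>c\<close> to the class representative \<open>a\<close>
    and on to \<open>d\<close> gives the conjugating element.\<close>
  have "d = inv (inv g \<otimes> h) \<otimes> c \<otimes> (inv g \<otimes> h)"
    using a g h by (simp add: c d m_assoc inv_mult_group inv_cancel_left)
  then show ?thesis using step[of "inv g \<otimes> h" c] g h assms(1) D_generates by simp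
qed

text \<open>Reading the map coordinatewise turns the eigenvalue equation into one about sums over
  neighbours.\<close>

lemma lookup_collinearity_map:
  assumes "v \<in> matsuo_space D" "x \<in> D"
  shows "Poly_Mapping.lookup (collinearity_map G D v) x =
    (\<Sum>e \<in> {e \<in> D. ord (x \<otimes> e) = 3}. Poly_Mapping.lookup v e)"
proof -
  have fin: "finite D" using finite_subset[OF D_subset finite_carrier] .
  have "Poly_Mapping.lookup (collinearity_map G D v) x =
      (\<Sum>e \<in> D. if ord (x \<otimes> e) = 3 then Poly_Mapping.lookup v e else 0)"
    using assms fin unfolding collinearity_map_def
    by (subst linear_extension_superset[of D])
      (auto simp: matsuo_space_def lookup_sum lookup_single when_def intro!: sum.cong)
  also have "\<dots> = (\<Sum>e \<in> {e \<in> D. ord (x \<otimes> e) = 3}. Poly_Mapping.lookup v e)"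
    using fin by (simp add: sum.inter_filter)
  finally show ?thesis .
qed

lemma valency_eigenvector_constant:
  fixes v :: "'a \<Rightarrow>\<^sub>0 'f::field_char_0"
  assumes "v \<in> eigenspace_in (matsuo_space D) (collinearity_map G D) (of_nat (valency G D d))"
    and "d \<in> D" "x \<in> D" "y \<in> D"
  shows "Poly_Mapping.lookup v x = Poly_Mapping.lookup v y"
proof (rule harmonic_constant[where V = D and N = "\<lambda>x. {e \<in> D. ord (x \<otimes> e) = 3}"])
  show "finite D" using finite_subset[OF D_subset finite_carrier] .
  fix z assume z: "z \<in> D"
  \<comment> \<open>By regularity the eigenvalue is the number of neighbours of \<open>z\<close>
    itself, so this equation says that the coefficients are harmonic at \<open>z\<close>.\<close>
  have "(\<Sum>e \<in> {e \<in> D. ord (z \<otimes> e) = 3}. Poly_Mapping.lookup v e)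
      = of_nat (valency G D z) * Poly_Mapping.lookup v z"
    using assms(1) lookup_collinearity_map[of v z] z valency_independent[OF assms(2) z]
    by (auto simp: eigenspace_in_def)
  then show "(\<Sum>e \<in> {e \<in> D. ord (z \<otimes> e) = 3}. Poly_Mapping.lookup v e - Poly_Mapping.lookup v z) = 0"
    by (simp add: sum_subtractf valency_def)
qed (use assms collinearity_connected in auto)

end

text \<open>Each coefficient is carried from \<open>e\<close> to \<open>\<sigma> e\<close>, which is
  still in \<open>D\<close>; exchanging the sums counts it once, at its source.\<close>

lemma lookup_flip_action_sum:
  assumes "finite D" "u \<in> matsuo_space D" "\<sigma> ` D \<subseteq> D"
  shows "(\<Sum>x \<in> D. Poly_Mapping.lookup (flip_action \<sigma> u) x) = (\<Sum>x \<in> D. Poly_Mapping.lookup u x)"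
proof -
  have "(\<Sum>x \<in> D. Poly_Mapping.lookup (flip_action \<sigma> u) x)
      = (\<Sum>x \<in> D. \<Sum>e \<in> D. if \<sigma> e = x then Poly_Mapping.lookup u e else 0)"
    using assms(1,2) unfolding flip_action_def
    by (subst linear_extension_superset[of D])
      (auto simp: matsuo_space_def lookup_sum lookup_single when_def intro!: sum.cong)
  also have "\<dots> = (\<Sum>e \<in> D. \<Sum>x \<in> D. if \<sigma> e = x then Poly_Mapping.lookup u e else 0)"
    by (rule sum.swap)
  also have "\<dots> = (\<Sum>x \<in> D. Poly_Mapping.lookup u x)"
    using assms by (intro sum.cong) auto
  finally show ?thesis .
qed

lemma lookup_flip_commutator_sum:
  assumes "finite D" "w \<in> flip_commutator D \<sigma>" "\<sigma> ` D \<subseteq> D"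
  shows "(\<Sum>x \<in> D. Poly_Mapping.lookup w x) = 0"
proof -
  obtain u where "u \<in> matsuo_space D" "w = u - flip_action \<sigma> u"
    using assms(2) by (auto simp: flip_commutator_def)
  then show ?thesis
    using lookup_flip_action_sum[OF assms(1) _ assms(3), of u]
    by (simp add: lookup_minus sum_subtractf)
qed

text \<open>This makes the constancy of eigenvectors in the whole space applicable to those in the
  commutator.\<close>

lemma flip_commutator_subset:
  assumes "\<sigma> ` D \<subseteq> D"
  shows "flip_commutator D \<sigma> \<subseteq> matsuo_space D"
proof
  fix w assume "w \<in> flip_commutator D \<sigma>"
  then obtain u where u: "Poly_Mapping.keys u \<subseteq> D" and w: "w = u - flip_action \<sigma> u"
    by (auto simp: flip_commutator_def matsuo_space_def)
  have "Poly_Mapping.lookup (flip_action \<sigma> u) x = 0" if "x \<notin> D" for x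
    using assms u that unfolding flip_action_def linear_extension_def lookup_sum
    by (intro sum.neutral) (auto simp: lookup_single when_def)
  then have "Poly_Mapping.lookup w x = 0" if "x \<notin> D" for x
    using u that by (auto simp: w lookup_minus in_keys_iff)
  then show "w \<in> matsuo_space D" by (auto simp: matsuo_space_def in_keys_iff)
qed

theorem proposition8p6:
  fixes G :: "('g, 'b) monoid_scheme" and D :: "'g set"
    and \<eta> :: "'f::field_char_0" and \<sigma> :: "'g \<Rightarrow> 'g"
    and d :: 'g and k m_k :: nat
  assumes "connected_three_transposition_group G D"
    and "\<eta> \<noteq> 0" and "\<eta> \<noteq> 1"
    and "flip G D \<sigma>"
    and "d \<in> D" and "k = valency G D d"
    and "m_k = free_space.dim
           (eigenspace_in (flip_commutator D \<sigma> :: ('g \<Rightarrow>\<^sub>0 'f) set) (collinearity_map G D) (of_nat k))"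
  shows "m_k = 0"
proof -
  interpret connected_three_transposition_group G D by fact
  have fin: "finite D" using finite_subset[OF D_subset finite_carrier] .
  have \<sigma>: "\<sigma> ` D \<subseteq> D" using \<open>flip G D \<sigma>\<close> by (simp add: flip_def)
  have "w = 0"
    if "w \<in> eigenspace_in (flip_commutator D \<sigma>) (collinearity_map G D) (of_nat k)"
    for w :: "'g \<Rightarrow>\<^sub>0 'f"
  proof -
    have w: "w \<in> flip_commutator D \<sigma>"
      and eig: "w \<in> eigenspace_in (matsuo_space D) (collinearity_map G D) (of_nat (valency G D d))"
      using that flip_commutator_subset[OF \<sigma>] \<open>k = valency G D d\<close>
      by (auto simp: eigenspace_in_def)
    have const: "Poly_Mapping.lookup w x = Poly_Mapping.lookup w d" if "x \<in> D" for x
      using valency_eigenvector_constant[OF eig \<open>d \<in> D\<close> that \<open>d \<in> D\<close>] .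
    have "0 = of_nat (card D) * Poly_Mapping.lookup w d"
      using lookup_flip_commutator_sum[OF fin w \<sigma>] const by simp
    \<comment> \<open>\<open>D\<close> is finite and contains \<open>d\<close>, so its cardinality
      is nonzero in characteristic 0.\<close>
    then have "Poly_Mapping.lookup w d = 0" using fin \<open>d \<in> D\<close> by auto
    then show "w = 0"
      using const eig
      by (intro poly_mapping_eqI) (auto simp: eigenspace_in_def matsuo_space_def in_keys_iff)
  qed
  \<comment> \<open>Lying in the span of the empty set bounds the dimension by its cardinality
    0.\<close>
  then have "eigenspace_in (flip_commutator D \<sigma>) (collinearity_map G D) (of_nat k)
      \<subseteq> free_space.span ({} :: ('g \<Rightarrow>\<^sub>0 'f) set)"
    by auto
  from free_space.dim_le_card[OF this] show ?thesis using assms(7) by simp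
qed

end
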